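(* Let $n,\ell\in\mathbb{Z}_{\geq 1}$. Put $m=1$, $\omega=(1,-\ell)$, $\lambda=(n)$ and $\mu=(0)$, both of which belong to $\mathcal{P}_{1,\ell}$, and let $\mathring{\lambda}$ and $\mathring{\mu}$ be the corresponding cylindric diagrams in $\mathbb{Z}^2/\mathbb{Z}(1,-\ell)$. Then $$f^{\mathring{\lambda}/\mathring{\mu}}=1=g^{\mathring{\lambda}/\mathring{\mu}}.$$
   Context: For $m,\ell\in\mathbb{Z}_{\ge1}$ put $\omega=(m,-\ell)$, $\mathcal{C}_\omega=\mathbb{Z}^2/\mathbb{Z}\omega$, and let $\pi:\mathbb{Z}^2\to\mathcal{C}_\omega$ be the projection. $\mathbb{Z}^2$ is partially ordered by $(a,b)\le(a',b')$ iff $a\le a'$ and $b\le b'$; $\mathcal{C}_\omega$ carries the induced partial order: $x\le y$ iff there are $\tilde x\in\pi^{-1}(x)$, $\tilde y\in\pi^{-1}(y)$ with $\tilde x\le\tilde y$. $\mathcal{P}_{m,\ell}$ is the set of integer sequences $\lambda=(\lambda_1,\dots,\lambda_m)$ with $\lambda_1\ge\cdots\ge\lambda_m$ and $\lambda_1-\lambda_m\le\ell$. For $\lambda\in\mathcal{P}_{m,\ell}$ put $\boldsymbol{\lambda}=\{(a,b)\in\mathbb{Z}^2\mid 1\le a\le m,\ b\le\lambda_a\}$, $\hat\lambda=\boldsymbol{\lambda}+\mathbb{Z}\omega$ (a periodic diagram) and $\mathring\lambda=\pi(\hat\lambda)\subset\mathcal{C}_\omega$ (a cylindric diagram). Let $\lambda,\mu\in\mathcal{P}_{m,\ell}$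 with $\mu_i\le\lambda_i$ for all $i$. The cylindric skew diagram is $\mathring\lambda/\mathring\mu=\mathring\lambda\setminus\mathring\mu$, a finite poset with $N=\sum_i(\lambda_i-\mu_i)$ elements. A linear extension of a finite poset $P$ with $N$ elements is a bijection $\varepsilon:P\to\{1,\dots,N\}$ with $x<y\Rightarrow\varepsilon(x)<\varepsilon(y)$. $f^{\mathring\lambda/\mathring\mu}$ is the number of linear extensions of $\mathring\lambda/\mathring\mu$. Excited diagrams: let $D\subset\hat\lambda$ satisfy $D+\omega=D$. A cell $(a,b)\in D$ is $D$-active if $(a+1,b),(a,b+1),(a+1,b+1)\in\hat\lambda\setminus D$. For a $D$-active cell $(a,b)$, the periodic elementary excitation replaces $D$ by $\bigl(D\setminus((a,b)+\mathbb{Z}\omega)\bigr)\cup\bigl((a+1,b+1)+\mathbb{Z}\omega\bigr)$. $\mathcal{E}_{\hat\lambda}(\hat\mu)$ is the set of all subsets of $\hat\lambda$ obtained from $\hat\mu$ by a finite (possibly empty) sequence of periodic elementary excitations at active cells, and $\mathcal{E}_{\mathring\lambda}(\mathring\mu)=\{\pi(D)\mid D\in\mathcal{E}_{\hat\lambda}(\hat\mu)\}$. Hook lengths: for $y\in\hat\lambda$, $h_{\hat\lambda}(y)$ is the number of cells of $\hat\lambda\cap\bigl(\{y+(k,0)\mid k\in\mathbb{Z}_{\ge0}\}\cup\{y+(0,k)\mid k\in\mathbb{Z}_{\ge1}\}\bigr)$; for $x\in\mathring\lambda$, $h_{\mathring\lambda}(x)=h_{\hat\lambda}(y)$ for any $y\in\pi^{-1}(x)$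 (well defined). Finally, $$g^{\mathring\lambda/\mathring\mu}=N!\sum_{D\in\mathcal{E}_{\mathring\lambda}(\mathring\mu)}\ \prod_{x\in\mathring\lambda\setminus D}\frac{1}{h_{\mathring\lambda}(x)},$$ a (possibly infinite) sum of positive terms. *)

theory Defs
  imports "HOL-Analysis.Analysis" "HOL-Library.Product_Order"
begin

type_synonym cell = "int \<times> int"

definition period :: "nat \<Rightarrow> nat \<Rightarrow> cell" where
  "period m l = (int m, - int l)"

text \<open>An element of the cylinder, i.e. of the quotient of the integer lattice by the multiples
  of \<open>w\<close>, is represented by the coset it is. Hence \<open>cyl_proj w p\<close> serves both as the projection of
  \<open>p\<close> to the cylinder and as the set of all translates of \<open>p\<close> by multiples of \<open>w\<close>.\<close>

definition cyl_proj :: "cell \<Rightarrow> cell \<Rightarrow> cell set" where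
  "cyl_proj w p = {p + (k * fst w, k * snd w) | k :: int. True}"

text \<open>The order on cells is the componentwise one of \<open>HOL-Library.Product_Order\<close>.\<close>

definition cyl_le :: "cell \<Rightarrow> cell set \<Rightarrow> cell set \<Rightarrow> bool" where
  "cyl_le w x y \<longleftrightarrow> (\<exists>p q. cyl_proj w p = x \<and> cyl_proj w q = y \<and> p \<le> q)"

text \<open>The sequence with entries indexed from 1 to \<open>m\<close> is a list, whose indices start at 0.\<close>

definition cyl_partitions :: "nat \<Rightarrow> nat \<Rightarrow> int list set" where
  "cyl_partitions m l =
    {lam. length lam = m \<and> sorted_wrt (\<ge>) lam \<and> hd lam - last lam \<le> int l}"

definition strip_diagram :: "nat \<Rightarrow> int list \<Rightarrow> cell set" where
  "strip_diagram m lam = {(a, b). 1 \<le> a \<and> a \<le> int m \<and> b \<le> lam ! nat (a - 1)}"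

definition periodic_diagram :: "nat \<Rightarrow> nat \<Rightarrow> int list \<Rightarrow> cell set" where
  "periodic_diagram m l lam = (\<Union>p \<in> strip_diagram m lam. cyl_proj (period m l) p)"

definition cylindric_diagram :: "nat \<Rightarrow> nat \<Rightarrow> int list \<Rightarrow> cell set set" where
  "cylindric_diagram m l lam = cyl_proj (period m l) ` periodic_diagram m l lam"

text \<open>The maps are restricted to \<open>P\<close> by extensionality, so that counting them is meaningful.\<close>

definition linear_extensions :: "('a \<Rightarrow> 'a \<Rightarrow> bool) \<Rightarrow> 'a set \<Rightarrow> ('a \<Rightarrow> nat) set" where
  "linear_extensions le P =
    {e \<in> extensional P. bij_betw e P {1..card P} \<and>
       (\<forall>x\<in>P. \<forall>y\<in>P. le x y \<and> x \<noteq> y \<longrightarrow> e x < e y)}"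

definition num_linear_extensions :: "nat \<Rightarrow> nat \<Rightarrow> int list \<Rightarrow> int list \<Rightarrow> nat" where
  "num_linear_extensions m l lam mu =
    card (linear_extensions (cyl_le (period m l))
      (cylindric_diagram m l lam - cylindric_diagram m l mu))"

definition active :: "cell set \<Rightarrow> cell set \<Rightarrow> cell \<Rightarrow> bool" where
  "active L D p \<longleftrightarrow> p \<in> D \<and> p + (1, 0) \<in> L - D \<and> p + (0, 1) \<in> L - D \<and> p + (1, 1) \<in> L - D"

definition excite :: "cell \<Rightarrow> cell set \<Rightarrow> cell \<Rightarrow> cell set" where
  "excite w D p = (D - cyl_proj w p) \<union> cyl_proj w (p + (1, 1))"

inductive_set periodic_excited :: "cell \<Rightarrow> cell set \<Rightarrow> cell set \<Rightarrow> cell set set"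
  for w :: cell and L :: "cell set" and M :: "cell set" where
  start: "M \<in> periodic_excited w L M"
| step: "\<lbrakk>D \<in> periodic_excited w L M; active L D p\<rbrakk> \<Longrightarrow> excite w D p \<in> periodic_excited w L M"

definition cylindric_excited :: "nat \<Rightarrow> nat \<Rightarrow> int list \<Rightarrow> int list \<Rightarrow> cell set set set" where
  "cylindric_excited m l lam mu =
    (\<lambda>D. cyl_proj (period m l) ` D) `
      periodic_excited (period m l) (periodic_diagram m l lam) (periodic_diagram m l mu)"

definition periodic_hook :: "cell set \<Rightarrow> cell \<Rightarrow> nat" where
  "periodic_hook L y =
    card (L \<inter> ({y + (k, 0) | k. k \<ge> 0} \<union> {y + (0, k) | k. k \<ge> 1}))"

definition cylindric_hook :: "nat \<Rightarrow> nat \<Rightarrow> int list \<Rightarrow> cell set \<Rightarrow> nat" where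
  "cylindric_hook m l lam x =
    periodic_hook (periodic_diagram m l lam) (SOME y. cyl_proj (period m l) y = x)"

definition skew_size :: "nat \<Rightarrow> int list \<Rightarrow> int list \<Rightarrow> nat" where
  "skew_size m lam mu = nat (\<Sum>i<m. lam ! i - mu ! i)"

text \<open>The terms are nonnegative, so the unordered sum is the right one. Should it diverge,
  \<open>infsum\<close> returns 0; any claim that \<open>hook_sum\<close> is nonzero therefore includes convergence.\<close>

definition hook_sum :: "nat \<Rightarrow> nat \<Rightarrow> int list \<Rightarrow> int list \<Rightarrow> real" where
  "hook_sum m l lam mu =
    fact (skew_size m lam mu) *
    (\<Sum>\<^sub>\<infinity>D\<in>cylindric_excited m l lam mu.
       \<Prod>x\<in>cylindric_diagram m l lam - D. 1 / real (cylindric_hook m l lam x))"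

end

theory Submission
  imports Defs
begin

text \<open>
  The map \<open>(a, b) \<mapsto> b + l (a - 1)\<close> identifies the cylinder of period \<open>(1, -l)\<close> with the chain of
  integers, so a finite skew diagram is a chain and has one linear extension. Measure positions by
  the distance \<open>d\<close> below the top level \<open>n\<close>; the hook length there is \<open>d + 1 + d div l\<close>, and an excited
  diagram is determined by the \<open>n\<close>-element set \<open>S\<close> of positions it leaves out, which is initially
  \<open>{0..<n}\<close>. Write \<open>n = q (l + 1) + r\<close> with \<open>r \<le> l\<close>. An excitation slides a block of \<open>l + 1\<close>
  consecutive elements of \<open>S\<close> one step to the right, so the reachable sets are \<open>{0..<r}\<close> together
  with \<open>q\<close> disjoint rods of length \<open>l + 1\<close>. Summing the product of inverse hook lengths over the
  positions of the last rod, then of the last but one, and so on, every sum telescopes because the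
  hook length grows by exactly \<open>i (l + 1)\<close> over \<open>i l\<close> positions. Since the hook lengths are the
  positive integers not divisible by \<open>l + 1\<close>, the resulting product is \<open>1 / n!\<close>.
\<close>

section \<open>Rod configurations and their elementary shifts\<close>

definition hook_len :: "nat \<Rightarrow> nat \<Rightarrow> nat" where
  "hook_len l d = d + 1 + d div l"

text \<open>Rods are listed from left to right: \<open>p\<close> is the start of the first one, and
  the others lie beyond its end, possibly touching it. The bound \<open>s\<close> lets every
  argument proceed by splitting off the first rod.\<close>

primrec rods :: "nat \<Rightarrow> nat \<Rightarrow> nat \<Rightarrow> nat set set" where
  "rods l 0 s = {{}}"
| "rods l (Suc q) s = (\<Union>p\<in>{s..}. (\<union>) {p..<p + l + 1} ` rods l q (p + l + 1))"

lemma rods_atLeast: "U \<in> rods l q s \<Longrightarrow> U \<subseteq> {s..}"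
proof (induction q arbitrary: U s)
  case (Suc q)
  then obtain p V where "p \<ge> s" "V \<in> rods l q (p + l + 1)" "U = {p..<p + l + 1} \<union> V"
    by auto
  with Suc.IH[of V "p + l + 1"] show ?case by auto
qed auto

lemma finite_rods: "U \<in> rods l q s \<Longrightarrow> finite U"
  by (induction q arbitrary: U s) auto

lemma rods_mono:
  assumes "s \<le> t"
  shows "rods l q t \<subseteq> rods l q s"
  using assms by (cases q) fastforce+

lemma base_in_rods: "{s..<s + q * (l + 1)} \<in> rods l q s"
proof (induction q arbitrary: s)
  case (Suc q)
  have "{s..<s + Suc q * (l + 1)} =
      {s..<s + l + 1} \<union> {s + l + 1..<s + l + 1 + q * (l + 1)}"
    by auto
  with Suc[of "s + l + 1"] show ?case
    by (auto intro!: bexI[of _ s])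
qed auto

text \<open>A first rod starting at \<open>s\<close> would contain \<open>s\<close>. The place thus
  left free is where a rod further left can slide.\<close>

lemma rods_Suc_start:
  assumes "U \<in> rods l q s" "s \<notin> U"
  shows "U \<in> rods l q (Suc s)"
proof (cases q)
  case 0
  then show ?thesis using assms by simp
next
  case (Suc q')
  then obtain p V where p: "p \<ge> s" "V \<in> rods l q' (p + l + 1)" "U = {p..<p + l + 1} \<union> V"
    using assms(1) by auto
  with assms(2) have "p \<noteq> s" by auto
  with p Suc show ?thesis by (auto intro!: bexI[of _ p])
qed

lemma rods_SucI:
  "\<lbrakk>p \<ge> s; V \<in> rods l q (p + l + 1)\<rbrakk> \<Longrightarrow> {p..<p + l + 1} \<union> V \<in> rods l (Suc q) s"
  by (simp only: rods.simps) blast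

lemma rods_SucE:
  assumes "U \<in> rods l (Suc q) s"
  obtains p V where "p \<ge> s" "V \<in> rods l q (p + l + 1)" "U = {p..<p + l + 1} \<union> V"
    "V \<subseteq> {p + l + 1..}"
proof -
  from assms obtain p V where p: "p \<in> {s..}" "V \<in> rods l q (p + l + 1)" "U = {p..<p + l + 1} \<union> V"
    by (simp only: rods.simps) blast
  from p(1) have "p \<ge> s" by simp
  from that[OF this p(2,3) rods_atLeast[OF p(2)]] show thesis .
qed

text \<open>An occupied place followed by a free one is the last place of a rod, so that rod can
  move right by one, gaining \<open>d\<close> and giving up its first place
  \<open>d - l - 1\<close>. The bound on \<open>d\<close> keeps this subtraction from
  truncating.\<close>

lemma rods_shift_right:
  assumes "U \<in> rods l q s" "d - 1 \<in> U" "d \<notin> U" "d > 0"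
  shows "d \<ge> s + l + 1 \<and> insert d (U - {d - l - 1}) \<in> rods l q s"
  using assms
proof (induction q arbitrary: U s)
  case (Suc q)
  from Suc.prems(1) obtain p V where p: "p \<ge> s" "V \<in> rods l q (p + l + 1)"
    and U: "U = {p..<p + l + 1} \<union> V" and V: "V \<subseteq> {p + l + 1..}"
    by (rule rods_SucE)
  have pV: "j \<notin> V" if "j < p + l + 1" for j using V that by fastforce
  show ?case
  proof (cases "d - 1 < p + l + 1")
    case True
    with pV Suc.prems(2) have "p \<le> d - 1" unfolding U by fastforce
    moreover from Suc.prems(3) have "d < p \<or> d \<ge> p + l + 1" unfolding U by auto
    ultimately have d: "d = p + l + 1" using Suc.prems(4) True by arith
    with Suc.prems(3) p(2) have "V \<in> rods l q (Suc p + l + 1)"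
      using rods_Suc_start[of V l q "p + l + 1"] unfolding U by simp
    then have "{Suc p..<Suc p + l + 1} \<union> V \<in> rods l (Suc q) s"
      using p(1) by (intro rods_SucI) auto
    moreover have "insert d ({p..<p + l + 1} - {p}) = {Suc p..<Suc p + l + 1}"
      unfolding d by auto
    moreover have "p \<notin> V" using pV by simp
    then have "insert d (U - {p}) = insert d ({p..<p + l + 1} - {p}) \<union> V"
      unfolding U by blast
    moreover have "d - l - 1 = p" using d by simp
    ultimately show ?thesis using p(1) d by simp
  next
    case False
    with Suc.prems(2) have "d - 1 \<in> V" unfolding U by simp
    with Suc.IH[OF p(2) this] Suc.prems(3,4)
    have d: "d \<ge> p + l + 1 + l + 1" "insert d (V - {d - l - 1}) \<in> rods l q (p + l + 1)"
      unfolding U by auto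
    have "p + l + 1 \<le> d - l - 1" using d(1) by arith
    then have "d - l - 1 \<notin> {p..<p + l + 1}" by simp
    then have "insert d (U - {d - l - 1}) = {p..<p + l + 1} \<union> insert d (V - {d - l - 1})"
      unfolding U by blast
    then show ?thesis using p(1) d rods_SucI[OF p(1) d(2)] by simp
  qed
qed simp

text \<open>The leftmost rod not pushed against its left neighbour or against \<open>s\<close> can
  move left by one; \<open>d\<close> is its last place. The memberships of \<open>d - 1\<close> and
  \<open>d - l\<close> make the reverse move an admissible excitation, and
  \<open>d - l - 1 \<notin> U\<close> makes it lead back to \<open>U\<close>.\<close>

lemma rods_shift_left:
  assumes "U \<in> rods l q s" "U \<noteq> {s..<s + q * (l + 1)}" "l \<ge> 1"
  shows "\<exists>d. d \<in> U \<and> d \<ge> s + l + 1 \<and> d - 1 \<in> U \<and> d - l \<in> U \<and> d - l - 1 \<notin> U \<and>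
    insert (d - l - 1) (U - {d}) \<in> rods l q s"
  using assms(1,2)
proof (induction q arbitrary: U s)
  case (Suc q)
  from Suc.prems(1) obtain p V where p: "p \<ge> s" "V \<in> rods l q (p + l + 1)"
    and U: "U = {p..<p + l + 1} \<union> V" and V: "V \<subseteq> {p + l + 1..}"
    by (rule rods_SucE)
  have pV: "j \<notin> V" if "j < p + l + 1" for j using V that by fastforce
  show ?case
  proof (cases "p = s")
    case False
    define p' where "p' = p - 1"
    have p': "p = Suc p'" "p' \<ge> s" using False p(1) by (auto simp: p'_def)
    have "V \<in> rods l q (p' + l + 1)"
      using rods_mono[of "p' + l + 1" "p + l + 1" l q] p(2) by (auto simp: p')
    then have "{p'..<p' + l + 1} \<union> V \<in> rods l (Suc q) s"
      using p' by (intro rods_SucI)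
    moreover have "insert p' ({p..<p + l + 1} - {p + l}) = {p'..<p' + l + 1}"
      unfolding p' by auto
    moreover have "p + l \<notin> V" using pV by simp
    then have "insert p' (U - {p + l}) = insert p' ({p..<p + l + 1} - {p + l}) \<union> V"
      unfolding U by blast
    moreover have "p' \<notin> U" using pV[of p'] by (simp add: U p')
    ultimately show ?thesis using assms(3) p'
      by (intro exI[of _ "p + l"]) (simp add: U)
  next
    case True
    have "{s..<s + Suc q * (l + 1)} =
        {p..<p + l + 1} \<union> {p + l + 1..<p + l + 1 + q * (l + 1)}"
      using True by auto
    with Suc.prems(2) have "V \<noteq> {p + l + 1..<p + l + 1 + q * (l + 1)}"
      unfolding U by metis
    from Suc.IH[OF p(2) this] obtain d where d: "d \<in> V" "d \<ge> p + l + 1 + l + 1" "d - 1 \<in> V"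
      "d - l \<in> V" "d - l - 1 \<notin> V" "insert (d - l - 1) (V - {d}) \<in> rods l q (p + l + 1)"
      by blast
    have "p + l + 1 \<le> d - l - 1" using d(2) by arith
    then have notin: "d \<notin> {p..<p + l + 1}" "d - l - 1 \<notin> {p..<p + l + 1}"
      using d(2) by simp_all
    then have "insert (d - l - 1) (U - {d}) = {p..<p + l + 1} \<union> insert (d - l - 1) (V - {d})"
      unfolding U by blast
    with rods_SucI[OF p(1) d(6)] have "insert (d - l - 1) (U - {d}) \<in> rods l (Suc q) s"
      by simp
    with d p(1) notin show ?thesis unfolding U by (intro exI[of _ d]) simp
  qed
qed simp

section \<open>Hook lengths and factorials\<close>

lemma hook_len_add_mult: "l \<ge> 1 \<Longrightarrow> hook_len l (d + q * l) = hook_len l d + q * (l + 1)"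
  by (simp add: hook_len_def algebra_simps)

lemma hook_len_pos: "hook_len l d > 0"
  by (simp add: hook_len_def)

text \<open>In increasing order the hook lengths are the positive integers not divisible by
  \<open>l + 1\<close>; those up to \<open>q * (l + 1) + r\<close> are the first
  \<open>q * l + r\<close>. The \<open>q\<close> multiples of \<open>l + 1\<close> account for the
  other factors.\<close>

lemma fact_eq_prod_hook_len:
  assumes "l \<ge> 1" "r \<le> l"
  shows "fact (q * (l + 1) + r) = (fact q * (l + 1) ^ q * (\<Prod>j<q * l + r. hook_len l j) :: nat)"
  using assms(2)
proof (induction q arbitrary: r)
  case 0
  then show ?case
  proof (induction r)
    case (Suc r)
    then show ?case by (simp add: hook_len_def)
  qed simp
next
  case (Suc q)
  from Suc.prems show ?case
  proof (induction r)
    case 0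
    have "fact (Suc q * (l + 1) + 0) = Suc q * (l + 1) * (fact (q * (l + 1) + l) :: nat)"
      using fact_Suc[of "q * (l + 1) + l"] by (simp add: algebra_simps)
    also have "(fact (q * (l + 1) + l) :: nat) =
        fact q * (l + 1) ^ q * (\<Prod>j<Suc q * l. hook_len l j)"
      using Suc.IH[of l] by (simp add: add.commute)
    finally show ?case by (simp only: fact_Suc power_Suc add_0_right of_nat_id mult_ac)
  next
    case (Suc r)
    \<comment> \<open>Here \<open>r < l\<close>, so \<open>r div l = 0\<close> and the next hook
      length is the next integer.\<close>
    have "hook_len l (Suc q * l + r) = hook_len l r + Suc q * (l + 1)"
      using hook_len_add_mult[OF assms(1), of r "Suc q"] by (simp only: add.commute)
    then have h: "hook_len l (Suc q * l + r) = Suc (Suc q * (l + 1) + r)"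
      using Suc.prems by (simp add: hook_len_def)
    have "fact (Suc q * (l + 1) + Suc r) = Suc (Suc q * (l + 1) + r) * (fact (Suc q * (l + 1) + r) :: nat)"
      by (simp only: add_Suc_right fact_Suc of_nat_id)
    also have "(fact (Suc q * (l + 1) + r) :: nat) =
        fact (Suc q) * (l + 1) ^ Suc q * (\<Prod>j<Suc q * l + r. hook_len l j)"
      using Suc by simp
    finally show ?case unfolding add_Suc_right prod.lessThan_Suc h by (simp only: mult_ac)
  qed
qed

section \<open>Summation over rod positions\<close>

lemma inj_on_rods_union:
  "inj_on (\<lambda>(p, V). {p..<p + l + 1} \<union> V) (SIGMA p:{s..}. rods l q (p + l + 1))"
proof (rule inj_onI, clarify)
  fix p V p' V'
  assume V: "V \<in> rods l q (p + l + 1)" "V' \<in> rods l q (p' + l + 1)"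
    and eq: "{p..<p + l + 1} \<union> V = {p'..<p' + l + 1} \<union> V'"
  have sub: "V \<subseteq> {p + l + 1..}" "V' \<subseteq> {p' + l + 1..}"
    using V by (auto dest: rods_atLeast)
  \<comment> \<open>Each start is the minimum of its union, which forces \<open>p = p'\<close>;
    removing the first rod then recovers \<open>V\<close>.\<close>
  have "p \<in> {p'..<p' + l + 1} \<union> V'" "p' \<in> {p..<p + l + 1} \<union> V"
    using eq by (auto simp flip: eq)
  with sub have "p = p'" by fastforce
  moreover from this have "V = V'"
    using eq sub by (auto simp: subset_iff set_eq_iff) (meson not_less)+
  ultimately show "p = p' \<and> V = V'" by simp
qed

text \<open>Moving on by \<open>Suc q * l\<close> places raises the hook length by the constant
  \<open>Suc q * (l + 1)\<close>, so each term is a difference of reciprocals of two products of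
  \<open>Suc q * l\<close> consecutive hook lengths. The summand has one factor more:
  \<open>l + 1\<close> from the first rod and \<open>q * l\<close> left over from summing over the
  others.\<close>

lemma has_sum_inverse_prod_hook_len:
  assumes "l \<ge> 1"
  shows "((\<lambda>p. (Suc q * (l + 1)) / (\<Prod>j=p..<p + Suc q * l + 1. real (hook_len l j))) has_sum
    1 / (\<Prod>j=s..<s + Suc q * l. real (hook_len l j))) {s..}"
proof -
  define Q where "Q = Suc q * l"
  have Q: "Q \<ge> 1" using assms by (simp add: Q_def)
  define T where "T p = 1 / (\<Prod>j=p..<p + Q. real (hook_len l j))" for p
  have h_pos: "real (hook_len l j) > 0" for j by (simp add: hook_len_pos)
  have step: "T p - T (Suc p) = (Suc q * (l + 1)) / (\<Prod>j=p..<p + Q + 1. real (hook_len l j))" for p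
  proof -
    define M where "M = (\<Prod>j=Suc p..<p + Q. real (hook_len l j))"
    have M: "M > 0" unfolding M_def by (intro prod_pos) (simp add: hook_len_pos)
    have 1: "(\<Prod>j=p..<p + Q. real (hook_len l j)) = hook_len l p * M"
      using Q by (simp add: M_def prod.atLeast_Suc_lessThan)
    have 2: "(\<Prod>j=Suc p..<Suc p + Q. real (hook_len l j)) = M * hook_len l (p + Q)"
      using Q by (simp add: M_def)
    have 3: "(\<Prod>j=p..<p + Q + 1. real (hook_len l j)) = hook_len l p * M * hook_len l (p + Q)"
      using Q 1 by simp
    have 4: "real (hook_len l (p + Q)) = real (hook_len l p) + real (Suc q * (l + 1))"
      using hook_len_add_mult[OF assms, of p "Suc q"] by (simp only: Q_def flip: of_nat_add)
    have 5: "real (Suc q * (l + 1)) > 0" by (simp only: of_nat_0_less_iff) simp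
    have "1 / (a * M) - 1 / (M * (a + x)) = x / (a * M * (a + x))" if "a > 0" "x > 0" for a x :: real
    proof -
      have "1 / (a * M) = (a + x) / (a * M * (a + x))" "1 / (M * (a + x)) = a / (a * M * (a + x))"
        using M that by auto
      then show ?thesis by (simp only: diff_divide_distrib[symmetric]) simp
    qed
    from this[OF h_pos 5] show ?thesis
      unfolding T_def 1 2 3 4 .
  qed
  have T_nonneg: "T p \<ge> 0" for p
    unfolding T_def by (intro divide_nonneg_nonneg prod_nonneg) auto
  \<comment> \<open>All hook lengths are at least 1, so a single factor bounds the product from
    below; this already makes the telescoping tail vanish.\<close>
  have T_le: "T p \<le> 1 / real (Suc p)" for p
  proof -
    have "real (Suc p) \<le> hook_len l p" by (simp add: hook_len_def)
    also have "\<dots> \<le> hook_len l p * (\<Prod>j=Suc p..<p + Q. real (hook_len l j))"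
    proof -
      have "1 \<le> (\<Prod>j=Suc p..<p + Q. real (hook_len l j))"
        by (intro prod_ge_1) (simp add: hook_len_def)
      then show ?thesis by (simp add: mult_le_cancel_left1)
    qed
    also have "\<dots> = (\<Prod>j=p..<p + Q. real (hook_len l j))"
      using Q by (simp add: prod.atLeast_Suc_lessThan)
    finally show ?thesis unfolding T_def by (intro divide_left_mono)
        (auto intro!: mult_pos_pos prod_pos simp: hook_len_pos)
  qed
  have "T \<longlonglongrightarrow> 0"
    by (rule tendsto_sandwich[OF _ _ tendsto_const lim_1_over_n[THEN LIMSEQ_Suc]])
      (auto intro!: always_eventually T_nonneg T_le[unfolded of_nat_Suc] simp: T_nonneg)
  then have "(\<lambda>i. T (i + s)) \<longlonglongrightarrow> 0"
    by (rule LIMSEQ_ignore_initial_segment)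
  then have "(\<lambda>i. T (i + s) - T (Suc i + s)) sums (T (0 + s) - 0)"
    by (rule telescope_sums')
  then have "((\<lambda>i. T (i + s) - T (Suc i + s)) has_sum T s) UNIV"
    by (intro sums_nonneg_imp_has_sum)
      (simp_all add: step prod_nonneg)
  then have "((\<lambda>p. T p - T (Suc p)) has_sum T s) {s..}"
    by (subst has_sum_reindex_bij_witness[of _ "\<lambda>i. i + s" "\<lambda>p. p - s" UNIV]) auto
  then show ?thesis unfolding step unfolding T_def Q_def .
qed

text \<open>For a fixed first rod, the induction hypothesis sums over the others and leaves the
  \<open>q * l\<close> hook lengths right after that rod. Joined with its own \<open>l + 1\<close>
  they form an unbroken product, and the sum over the start of the first rod telescopes.\<close>

lemma has_sum_rods:
  assumes "l \<ge> 1"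
  shows "((\<lambda>U. \<Prod>d\<in>U. 1 / real (hook_len l d)) has_sum
    1 / (fact q * real (l + 1) ^ q * (\<Prod>j=s..<s + q * l. real (hook_len l j)))) (rods l q s)"
proof (induction q arbitrary: s)
  case 0
  have "((\<lambda>U. \<Prod>d\<in>U. 1 / real (hook_len l d)) has_sum 1) {{}}"
    by (rule has_sum_finiteI) auto
  then show ?case by simp
next
  case (Suc q)
  define w where "w U = (\<Prod>d\<in>U. 1 / real (hook_len l d))" for U
  \<comment> \<open>\<open>c\<close> is the constant of the goal; splitting it off gives
    \<open>g\<close> the numerator of the telescoping sum.\<close>
  define c where "c = 1 / (fact (Suc q) * real (l + 1) ^ Suc q :: real)"
  define g where "g p = c * (real (Suc q * (l + 1)) / (\<Prod>j=p..<p + Suc q * l + 1. real (hook_len l j)))" for p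
  define f where "f = (\<lambda>(p, V). w ({p..<p + l + 1} \<union> V))"
  have w_nonneg: "w U \<ge> 0" for U unfolding w_def by (intro prod_nonneg) auto
  have inner: "((\<lambda>V. f (p, V)) has_sum g p) (rods l q (p + l + 1))" for p
  proof -
    have f_eq: "f (p, V) = w {p..<p + l + 1} * w V" if "V \<in> rods l q (p + l + 1)" for V
      using rods_atLeast[OF that] finite_rods[OF that] unfolding f_def w_def
      by (simp only: prod.case) (subst prod.union_disjoint, auto)
    have g_eq: "g p = w {p..<p + l + 1} *
        (1 / (fact q * real (l + 1) ^ q * (\<Prod>j=p + l + 1..<p + l + 1 + q * l. real (hook_len l j))))"
    proof -
      have "{p..<p + Suc q * l + 1} = {p..<p + l + 1} \<union> {p + l + 1..<p + l + 1 + q * l}"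
        by auto
      then have "(\<Prod>j=p..<p + Suc q * l + 1. real (hook_len l j)) =
          (\<Prod>j=p..<p + l + 1. real (hook_len l j)) *
          (\<Prod>j=p + l + 1..<p + l + 1 + q * l. real (hook_len l j))"
        by (simp only:) (subst prod.union_disjoint, auto)
      moreover have "c * real (Suc q * (l + 1)) = 1 / (fact q * real (l + 1) ^ q)"
      proof -
        have eq: "fact (Suc q) * real (l + 1) ^ Suc q =
            real (Suc q * (l + 1)) * (fact q * real (l + 1) ^ q)"
          by (simp only: fact_Suc power_Suc of_nat_mult mult_ac)
        have "1 / (a * b) * a = 1 / b" if "a \<noteq> 0" for a b :: real
          using that by simp
        moreover have "real (Suc q * (l + 1)) \<noteq> 0"
          by (simp only: of_nat_eq_0_iff) simp
        ultimately show ?thesis unfolding c_def eq by blast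
      qed
      ultimately show ?thesis
        unfolding g_def w_def times_divide_eq_right by (simp add: prod_dividef)
    qed
    have "((\<lambda>V. w {p..<p + l + 1} * w V) has_sum g p) (rods l q (p + l + 1))"
      unfolding g_eq unfolding w_def by (rule has_sum_cmult_right[OF Suc.IH])
    moreover have "((\<lambda>V. f (p, V)) has_sum g p) (rods l q (p + l + 1)) \<longleftrightarrow>
        ((\<lambda>V. w {p..<p + l + 1} * w V) has_sum g p) (rods l q (p + l + 1))"
      by (rule has_sum_cong) (rule f_eq)
    ultimately show ?thesis by blast
  qed
  have outer: "(g has_sum c * (1 / (\<Prod>j=s..<s + Suc q * l. real (hook_len l j)))) {s..}"
    unfolding g_def by (intro has_sum_cmult_right has_sum_inverse_prod_hook_len assms)
  \<comment> \<open>All weights are nonnegative, so summability of the inner sums over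
    \<open>p\<close> gives summability over the pairs.\<close>
  have "f summable_on (SIGMA p:{s..}. rods l q (p + l + 1))"
    by (rule summable_on_SigmaI[OF inner]) (use outer in \<open>auto simp: summable_on_def f_def w_nonneg\<close>)
  then have "(f has_sum c * (1 / (\<Prod>j=s..<s + Suc q * l. real (hook_len l j))))
      (SIGMA p:{s..}. rods l q (p + l + 1))"
    by (intro has_sum_SigmaI[OF inner outer])
  moreover have "rods l (Suc q) s =
      (\<lambda>(p, V). {p..<p + l + 1} \<union> V) ` (SIGMA p:{s..}. rods l q (p + l + 1))"
    by (auto simp: image_iff)
  moreover have "f = w \<circ> (\<lambda>(p, V). {p..<p + l + 1} \<union> V)"
    by (auto simp: f_def)
  ultimately show ?case
    by (simp only: has_sum_reindex[OF inj_on_rods_union] flip: w_def) (simp add: c_def)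
qed

section \<open>Linear extensions of a finite chain\<close>

lemma card_linear_extensions_total:
  assumes "finite P"
    and refl: "\<And>x. x \<in> P \<Longrightarrow> le x x"
    and trans: "\<And>x y z. \<lbrakk>x \<in> P; y \<in> P; z \<in> P; le x y; le y z\<rbrakk> \<Longrightarrow> le x z"
    and antisym: "\<And>x y. \<lbrakk>x \<in> P; y \<in> P; le x y; le y x\<rbrakk> \<Longrightarrow> x = y"
    and total: "\<And>x y. \<lbrakk>x \<in> P; y \<in> P\<rbrakk> \<Longrightarrow> le x y \<or> le y x"
  shows "card (linear_extensions le P) = 1"
proof -
  \<comment> \<open>Each element counts itself, so ranks start at 1; \<open>restrict\<close>
    supplies the extensional default outside \<open>P\<close>.\<close>
  define rank where "rank = restrict (\<lambda>x. card {z \<in> P. le z x}) P"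
  have rank_less: "rank x < rank y" if "x \<in> P" "y \<in> P" "le x y" "x \<noteq> y" for x y
  proof -
    have "{z \<in> P. le z x} \<subset> {z \<in> P. le z y}"
      using that refl[of y] antisym[of x y] trans by blast
    then show ?thesis using that \<open>finite P\<close> by (simp add: rank_def psubset_card_mono)
  qed
  have "inj_on rank P"
    using rank_less total by (metis inj_onI less_irrefl)
  moreover have "rank ` P \<subseteq> {1..card P}"
  proof
    fix k assume "k \<in> rank ` P"
    then obtain x where x: "x \<in> P" "k = card {z \<in> P. le z x}" by (auto simp: rank_def)
    then have "{z \<in> P. le z x} \<noteq> {}" using refl by blast
    then show "k \<in> {1..card P}"
      using x \<open>finite P\<close> by (auto simp: Suc_le_eq card_gt_0_iff intro!: card_mono)
  qed
  ultimately have "bij_betw rank P {1..card P}"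
    using card_subset_eq[of "{1..card P}" "rank ` P"] by (simp add: bij_betw_def card_image)
  then have "rank \<in> linear_extensions le P"
    unfolding linear_extensions_def using rank_less by (auto simp: rank_def)
  moreover have "e = rank" if e: "e \<in> linear_extensions le P" for e
  proof
    fix x
    have ext: "e \<in> extensional P" and bij: "bij_betw e P {1..card P}"
      and mono: "\<And>x y. \<lbrakk>x \<in> P; y \<in> P; le x y; x \<noteq> y\<rbrakk> \<Longrightarrow> e x < e y"
      using e by (auto simp: linear_extensions_def)
    show "e x = rank x"
    proof (cases "x \<in> P")
      case True
      \<comment> \<open>Totality turns strict monotonicity into an equivalence, so \<open>e\<close>
        maps the elements below \<open>x\<close> bijectively onto \<open>{1..e x}\<close> and must
        agree with \<open>rank\<close>.\<close>
      have le_iff: "le z x \<longleftrightarrow> e z \<le> e x" if "z \<in> P" for z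
        using mono[OF that True] mono[OF True that] total[OF that True] refl[OF that]
        by (cases "z = x") auto
      have ex: "e x \<in> {1..card P}" using bij True by (auto simp: bij_betw_def)
      have "e ` {z \<in> P. le z x} = {1..e x}"
      proof
        show "e ` {z \<in> P. le z x} \<subseteq> {1..e x}"
          using bij by (auto simp: bij_betw_def le_iff)
        show "{1..e x} \<subseteq> e ` {z \<in> P. le z x}"
        proof
          fix k assume k: "k \<in> {1..e x}"
          with ex have "k \<in> e ` P" using bij by (auto simp: bij_betw_def)
          with k show "k \<in> e ` {z \<in> P. le z x}" by (auto simp: le_iff)
        qed
      qed
      moreover have "inj_on e {z \<in> P. le z x}"
        using bij by (auto simp: bij_betw_def intro: inj_on_subset)
      ultimately have "card {z \<in> P. le z x} = e x"
        by (metis card_image card_atLeastAtMost diff_Suc_1)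
      then show ?thesis using True by (simp add: rank_def)
    next
      case False
      then show ?thesis using ext by (simp add: rank_def extensional_def)
    qed
  qed
  ultimately have "linear_extensions le P = {rank}" by blast
  then show ?thesis by simp
qed

section \<open>The cylinder of width one as a chain\<close>

definition level :: "nat \<Rightarrow> cell \<Rightarrow> int" where
  "level l p = snd p + int l * (fst p - 1)"

definition slice :: "nat \<Rightarrow> int \<Rightarrow> cell set" where
  "slice l c = {p. level l p = c}"

lemma level_simps [simp]:
  "level l (1, c) = c"
  "level l (p + (a, b)) = level l p + b + int l * a"
  by (simp_all add: level_def algebra_simps)

lemma inj_slice: "inj (slice l)"
proof (rule injI)
  fix c c' assume "slice l c = slice l c'"
  moreover have "(1, c) \<in> slice l c" by (simp add: slice_def)
  ultimately have "(1, c) \<in> slice l c'" by simp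
  then show "c = c'" by (simp add: slice_def)
qed

text \<open>The period has first coordinate 1, so two cells of equal level differ by the multiple of
  it given by the difference of their first coordinates.\<close>

lemma cyl_proj_eq_slice: "cyl_proj (period 1 l) p = slice l (level l p)"
proof
  show "cyl_proj (period 1 l) p \<subseteq> slice l (level l p)"
    by (auto simp: cyl_proj_def period_def slice_def)
  show "slice l (level l p) \<subseteq> cyl_proj (period 1 l) p"
  proof
    fix x assume "x \<in> slice l (level l p)"
    then have "x = p + ((fst x - fst p) * fst (period 1 l), (fst x - fst p) * snd (period 1 l))"
      by (simp add: slice_def level_def period_def prod_eq_iff algebra_simps)
    then show "x \<in> cyl_proj (period 1 l) p" unfolding cyl_proj_def by blast
  qed
qed

lemma periodic_diagram_single: "periodic_diagram 1 l [c] = {p. level l p \<le> c}"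
proof -
  have "strip_diagram 1 [c] = Pair 1 ` {..c}"
    by (auto simp: strip_diagram_def image_iff)
  then show ?thesis
    by (auto simp: periodic_diagram_def cyl_proj_eq_slice[unfolded One_nat_def] slice_def)
qed

lemma image_cyl_proj: "cyl_proj (period 1 l) ` {p. Q (level l p)} = slice l ` {c. Q c}"
proof -
  have "level l ` {p. Q (level l p)} = {c. Q c}"
    by (auto simp: image_iff) (metis level_simps(1))
  moreover have "cyl_proj (period 1 l) = slice l \<circ> level l"
    by (rule ext) (simp only: o_apply cyl_proj_eq_slice)
  ultimately show ?thesis by (metis image_comp)
qed

lemma cylindric_diagram_single: "cylindric_diagram 1 l [c] = slice l ` {..c}"
  unfolding cylindric_diagram_def periodic_diagram_single atMost_def by (rule image_cyl_proj)

text \<open>\<open>level\<close> is monotone because its coefficients 1 and \<open>l\<close> are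
  nonnegative; conversely, the representatives with first coordinate 1 are already
  comparable.\<close>

lemma cyl_le_slice: "cyl_le (period 1 l) (slice l c) (slice l c') \<longleftrightarrow> c \<le> c'"
proof
  assume "cyl_le (period 1 l) (slice l c) (slice l c')"
  then obtain p q where pq: "level l p = c" "level l q = c'" "p \<le> q"
    unfolding cyl_le_def cyl_proj_eq_slice by (metis inj_slice injD)
  then have "snd p \<le> snd q" "int l * (fst p - 1) \<le> int l * (fst q - 1)"
    by (auto simp: less_eq_prod_def intro: mult_left_mono)
  with pq show "c \<le> c'" by (simp add: level_def)
next
  assume "c \<le> c'"
  then have "cyl_proj (period 1 l) (1, c) = slice l c \<and>
      cyl_proj (period 1 l) (1, c') = slice l c' \<and> (1, c) \<le> (1 :: int, c')"
    by (simp add: cyl_proj_eq_slice[of l] del: One_nat_def)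
  then show "cyl_le (period 1 l) (slice l c) (slice l c')"
    unfolding cyl_le_def by blast
qed

lemma num_linear_extensions_single:
  "num_linear_extensions 1 l [int n] [0] = 1"
proof -
  have P: "cylindric_diagram 1 l [int n] - cylindric_diagram 1 l [0] = slice l ` {0<..int n}"
    unfolding cylindric_diagram_single
    by (subst image_set_diff[OF inj_slice, symmetric]) (auto intro!: arg_cong[of _ _ "image _"])
  show ?thesis
    unfolding num_linear_extensions_def P
    by (rule card_linear_extensions_total) 
      (simp, (elim imageE; metis cyl_le_slice order_refl order_trans order_antisym linear)+)
qed

section \<open>Excited diagrams as rod configurations\<close>

definition hole_diagram :: "nat \<Rightarrow> nat \<Rightarrow> nat set \<Rightarrow> cell set" where
  "hole_diagram l n S = {p. level l p \<le> int n \<and> nat (int n - level l p) \<notin> S}"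

text \<open>The neighbours of a cell lie 1, \<open>l\<close> and \<open>l + 1\<close> levels higher.
  The condition \<open>d \<ge> l + 1\<close> says that the diagonal one is still in the diagram, so
  that no natural subtraction truncates.\<close>

lemma active_hole_diagram:
  "active {p. level l p \<le> int n} (hole_diagram l n S) p \<longleftrightarrow>
    (\<exists>d. level l p = int n - int d \<and> d \<ge> l + 1 \<and> d \<notin> S \<and> d - 1 \<in> S \<and> d - l \<in> S \<and> d - l - 1 \<in> S)"
proof (cases "level l p \<le> int n")
  case True
  define d where "d = nat (int n - level l p)"
  have c: "level l p = int n - int d" using True by (simp add: d_def)
  have sub: "nat (int d - 1) = d - 1" "nat (int d - int l) = d - l" "nat (int d - (1 + int l)) = d - l - 1"
    "nat (int d - 1 - int l) = d - l - 1"
    by arith+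
  show ?thesis
    unfolding active_def hole_diagram_def
    by (auto simp: c sub algebra_simps)
next
  case False
  then show ?thesis by (auto simp: active_def hole_diagram_def)
qed

text \<open>The cell rises from distance \<open>d\<close> to \<open>d - l - 1\<close>, so the hole
  moves the opposite way.\<close>

lemma excite_hole_diagram:
  assumes "level l p = int n - int d" "d \<ge> l + 1"
  shows "excite (period 1 l) (hole_diagram l n S) p = hole_diagram l n (insert d (S - {d - l - 1}))"
proof (rule set_eqI)
  fix x
  \<comment> \<open>Above level \<open>n\<close> the term \<open>nat (int n - level l x)\<close> is
    0, so there the bound on the level in \<open>hole_diagram\<close> has to decide.\<close>
  consider "level l x > int n" | e where "level l x = int n - int e"
    by (metis add_diff_cancel_left' diff_add_cancel not_less zle_iff_zadd)
  then show "x \<in> excite (period 1 l) (hole_diagram l n S) p \<longleftrightarrow>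
      x \<in> hole_diagram l n (insert d (S - {d - l - 1}))"
  proof cases
    case 1
    then show ?thesis using assms
      by (auto simp: excite_def cyl_proj_eq_slice[of l] slice_def hole_diagram_def simp del: One_nat_def)
  next
    case 2
    have "int n - int d + 1 + int l = int n - int (d - l - 1)" using assms(2) by auto
    with 2 show ?thesis using assms
      by (auto simp: excite_def cyl_proj_eq_slice[of l] slice_def hole_diagram_def simp del: One_nat_def)
  qed
qed

text \<open>Excitations are right shifts of rods, which gives one inclusion. For the other, a
  configuration is moved left until it is packed, and the moves are reversed. The holes
  \<open>{..<r}\<close> stay fixed.\<close>

lemma periodic_excited_single:
  assumes "l \<ge> 1" "r \<le> l" and n: "n = q * (l + 1) + r"
  shows "periodic_excited (period 1 l) (periodic_diagram 1 l [int n]) (periodic_diagram 1 l [0]) =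
    (\<lambda>U. hole_diagram l n ({..<r} \<union> U)) ` rods l q r"
    (is "?E = ?H ` _")
proof
  have "{..<r} \<union> {r..<r + q * (l + 1)} = {..<n}"
    unfolding n by auto
  then have "?H {r..<r + q * (l + 1)} = hole_diagram l n {..<n}"
    by (simp only:)
  also have "\<dots> = periodic_diagram 1 l [0]"
    unfolding periodic_diagram_single hole_diagram_def by auto
  finally have base: "?H {r..<r + q * (l + 1)} = periodic_diagram 1 l [0]" .
  show "?E \<subseteq> ?H ` rods l q r"
  proof
    fix D assume "D \<in> ?E"
    then show "D \<in> ?H ` rods l q r"
    proof induction
      case start
      show ?case unfolding base[symmetric] by (intro imageI base_in_rods)
    next
      case (step D p)
      then obtain U where U: "U \<in> rods l q r" "D = ?H U" by blast
      from step.hyps(2) obtain d where d: "level l p = int n - int d" "d \<ge> l + 1"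
        "d \<notin> {..<r} \<union> U" "d - 1 \<in> {..<r} \<union> U"
        unfolding U periodic_diagram_single active_hole_diagram by blast
      \<comment> \<open>From \<open>d - 1 \<ge> l \<ge> r\<close>, the place before \<open>d\<close>
        is not among the fixed holes, so it belongs to a rod.\<close>
      have "d - 1 \<notin> {..<r}" "d > 0" using d(2) assms(2) by simp_all
      with d(3,4) have "d - 1 \<in> U" "d \<notin> U" by blast+
      from rods_shift_right[OF U(1) this \<open>d > 0\<close>]
      have right: "d \<ge> r + l + 1" "insert d (U - {d - l - 1}) \<in> rods l q r"
        by blast+
      have "d - l - 1 \<notin> {..<r}" using right(1) by simp
      then have "insert d (({..<r} \<union> U) - {d - l - 1}) = {..<r} \<union> insert d (U - {d - l - 1})"
        by blast
      then have "excite (period 1 l) D p = ?H (insert d (U - {d - l - 1}))"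
        using excite_hole_diagram[OF d(1,2), of "{..<r} \<union> U"] by (simp only: U(2))
      then show ?case using right(2) by (rule image_eqI)
    qed
  qed
  show "?H ` rods l q r \<subseteq> ?E"
  proof (intro image_subsetI)
    fix U assume "U \<in> rods l q r"
    then show "?H U \<in> ?E"
    \<comment> \<open>A left shift replaces \<open>d\<close> by \<open>d - l - 1\<close> and so
      decreases the sum of the positions.\<close>
    proof (induction "\<Sum>U" arbitrary: U rule: less_induct)
      case less
      show ?case
      proof (cases "U = {r..<r + q * (l + 1)}")
        case True
        show ?thesis unfolding True base by (rule periodic_excited.start)
      next
        case False
        from rods_shift_left[OF less.prems False assms(1)] obtain d where d: "d \<in> U" "d \<ge> r + l + 1"
          "d - 1 \<in> U" "d - l \<in> U" "d - l - 1 \<notin> U" "insert (d - l - 1) (U - {d}) \<in> rods l q r"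
          by blast
        define V where "V = insert (d - l - 1) (U - {d})"
        have "finite U" using less.prems by (rule finite_rods)
        then have "\<Sum>V = (d - l - 1) + \<Sum>(U - {d})" using d(5) by (simp add: V_def)
        also have "\<dots> < d + \<Sum>(U - {d})" using d(2) by simp
        also have "\<dots> = \<Sum>U" using \<open>finite U\<close> d(1) by (simp add: sum.remove)
        finally have "?H V \<in> ?E" using less.hyps[of V] d(6) by (simp add: V_def)
        moreover have lev: "level l (1, int n - int d) = int n - int d" by simp
        moreover have "active {p. level l p \<le> int n} (?H V) (1, int n - int d)"
        proof -
          have "d - 1 \<noteq> d" "d - l \<noteq> d" "d \<noteq> d - l - 1" "d \<notin> {..<r}"
            using d(2) assms(1) by simp_all
          with d(3,4) have "d \<notin> {..<r} \<union> V" "d - 1 \<in> {..<r} \<union> V" "d - l \<in> {..<r} \<union> V"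
            "d - l - 1 \<in> {..<r} \<union> V"
            unfolding V_def by blast+
          moreover have "d \<ge> l + 1" using d(2) by simp
          ultimately show ?thesis
            unfolding active_hole_diagram using lev by blast
        qed
        ultimately have "excite (period 1 l) (?H V) (1, int n - int d) \<in> ?E"
          unfolding periodic_diagram_single by (intro periodic_excited.step)
        moreover have "excite (period 1 l) (?H V) (1, int n - int d) =
            hole_diagram l n (insert d (({..<r} \<union> V) - {d - l - 1}))"
          using d(2) by (intro excite_hole_diagram lev) simp
        moreover have "d - l - 1 \<notin> {..<r}" using d(2) by simp
        then have "insert d (({..<r} \<union> V) - {d - l - 1}) = {..<r} \<union> U"
          using d(1,5) unfolding V_def by blast
        ultimately show ?thesis by simp
      qed
    qed
  qed
qed

section \<open>Hook lengths on the cylinder and the hook sum\<close>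

lemma cylindric_hook_single:
  assumes "l \<ge> 1"
  shows "cylindric_hook 1 l [int n] (slice l (int n - int d)) = hook_len l d"
proof -
  \<comment> \<open>Whichever representative is chosen, its level is \<open>int n - int d\<close>,
    and only this enters the count.\<close>
  define y where "y = (SOME y. cyl_proj (period 1 l) y = slice l (int n - int d))"
  have "cyl_proj (period 1 l) (1, int n - int d) = slice l (int n - int d)"
    unfolding cyl_proj_eq_slice by simp
  then have "cyl_proj (period 1 l) y = slice l (int n - int d)"
    unfolding y_def by (rule someI)
  then have y: "level l y = int n - int d"
    unfolding cyl_proj_eq_slice by (rule injD[OF inj_slice])
  \<comment> \<open>A step \<open>(k, 0)\<close> raises the level by \<open>l * k\<close> and a step
    \<open>(0, k)\<close> by \<open>k\<close>, so the first direction allows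
    \<open>d div l + 1\<close> cells including \<open>y\<close> itself, the second
    \<open>d\<close>.\<close>
  have "{p. level l p \<le> int n} \<inter> ({y + (k, 0) |k. k \<ge> 0} \<union> {y + (0, k) |k. k \<ge> 1}) =
      (\<lambda>k. y + (int k, 0)) ` {..d div l} \<union> (\<lambda>k. y + (0, int k)) ` {1..d}" (is "?L = ?A \<union> ?B")
  proof -
    have arm: "int l * k \<le> int d \<longleftrightarrow> (\<exists>j\<le>d div l. k = int j)" if "k \<ge> 0" for k
    proof -
      from that obtain j where j: "k = int j" by (metis nonneg_int_cases)
      have "int l * k \<le> int d \<longleftrightarrow> l * j \<le> d" unfolding j by (metis of_nat_le_iff of_nat_mult)
      also have "\<dots> \<longleftrightarrow> j \<le> d div l"
        using assms by (simp add: less_eq_div_iff_mult_less_eq mult.commute)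
      finally show ?thesis by (auto simp: j)
    qed
    have leg: "k \<le> int d \<longleftrightarrow> (\<exists>j\<in>{1..d}. k = int j)" if "k \<ge> 1" for k
      using that by (auto intro!: bexI[of _ "nat k"])
    show ?thesis
      by (auto simp: y arm leg image_iff)
  qed
  moreover have "card (?A \<union> ?B) = card ?A + card ?B"
    by (rule card_Un_disjoint) auto
  moreover have "card ?A = d div l + 1" "card ?B = d"
    by (subst card_image; auto simp: inj_on_def)+
  ultimately show ?thesis
    unfolding cylindric_hook_def y_def[symmetric] periodic_hook_def periodic_diagram_single
    by (simp add: hook_len_def)
qed

lemma hook_sum_single:
  assumes "l \<ge> 1"
  shows "hook_sum 1 l [int n] [0] = 1"
proof -
  define q r where "q = n div (l + 1)" and "r = n mod (l + 1)"
  have n: "n = q * (l + 1) + r" by (simp only: q_def r_def div_mult_mod_eq)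
  have r: "r \<le> l" using mod_less_divisor[of "l + 1" n] by (simp add: r_def)
  define w where "w S = (\<Prod>d\<in>S. 1 / real (hook_len l d))" for S
  define X where "X S = slice l ` {c. c \<le> int n \<and> nat (int n - c) \<notin> S}" for S
  have X: "cyl_proj (period 1 l) ` hole_diagram l n S = X S" for S
    unfolding hole_diagram_def X_def by (rule image_cyl_proj)
  have compl: "cylindric_diagram 1 l [int n] - X S = (\<lambda>d. slice l (int n - int d)) ` S" for S
  proof -
    have "cylindric_diagram 1 l [int n] - X S = slice l ` ({..int n} - {c. c \<le> int n \<and> nat (int n - c) \<notin> S})"
      unfolding cylindric_diagram_single X_def by (rule image_set_diff[OF inj_slice, symmetric])
    also have "{..int n} - {c. c \<le> int n \<and> nat (int n - c) \<notin> S} = (\<lambda>d. int n - int d) ` S"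
    proof
      show "{..int n} - {c. c \<le> int n \<and> nat (int n - c) \<notin> S} \<subseteq> (\<lambda>d. int n - int d) ` S"
      proof
        fix c assume "c \<in> {..int n} - {c. c \<le> int n \<and> nat (int n - c) \<notin> S}"
        then have "c = int n - int (nat (int n - c))" "nat (int n - c) \<in> S" by auto
        then show "c \<in> (\<lambda>d. int n - int d) ` S" by (rule image_eqI)
      qed
    qed auto
    finally show ?thesis by (simp add: image_image)
  qed
  have inj: "inj_on (\<lambda>d. slice l (int n - int d)) S" for S
    by (rule inj_onI) (auto dest: injD[OF inj_slice])
  have term_eq: "(\<Prod>x\<in>cylindric_diagram 1 l [int n] - X S. 1 / real (cylindric_hook 1 l [int n] x)) = w S" for S
    unfolding compl w_def
    by (subst prod.reindex[OF inj]) (simp only: o_def cylindric_hook_single[OF assms])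
  have excited: "cylindric_excited 1 l [int n] [0] = (\<lambda>U. X ({..<r} \<union> U)) ` rods l q r"
    unfolding cylindric_excited_def periodic_excited_single[OF assms r n]
    by (simp only: image_image X)
  \<comment> \<open>The sum runs over a set of diagrams, so distinct configurations must give
    distinct diagrams. The complement of a diagram recovers its holes, and \<open>U\<close> is the
    part of them in \<open>{r..}\<close>.\<close>
  have inj_X: "inj_on (\<lambda>U. X ({..<r} \<union> U)) (rods l q r)"
  proof (rule inj_onI)
    fix U V assume UV: "U \<in> rods l q r" "V \<in> rods l q r" "X ({..<r} \<union> U) = X ({..<r} \<union> V)"
    then have "(\<lambda>d. slice l (int n - int d)) ` ({..<r} \<union> U) =
        (\<lambda>d. slice l (int n - int d)) ` ({..<r} \<union> V)"
      by (simp only: flip: compl)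
    then have "{..<r} \<union> U = {..<r} \<union> V"
      by (simp only: inj_image_eq_iff[OF inj])
    moreover have "U \<subseteq> - {..<r}" "V \<subseteq> - {..<r}"
      using UV(1,2)[THEN rods_atLeast] by (simp_all add: Compl_lessThan)
    ultimately show "U = V" by blast
  qed
  have w_split: "w ({..<r} \<union> U) = w {..<r} * w U" if "U \<in> rods l q r" for U
  proof -
    have "{..<r} \<inter> U = {}" using rods_atLeast[OF that] by (auto simp: subset_iff)
    then show ?thesis unfolding w_def by (intro prod.union_disjoint finite_rods[OF that]) simp_all
  qed
  define W where "W = 1 / (fact q * real (l + 1) ^ q * (\<Prod>j=r..<r + q * l. real (hook_len l j)))"
  have "((\<lambda>U. w {..<r} * w U) has_sum w {..<r} * W) (rods l q r)"
    unfolding w_def W_def by (intro has_sum_cmult_right has_sum_rods assms)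
  moreover have "((\<lambda>U. w ({..<r} \<union> U)) has_sum w {..<r} * W) (rods l q r) \<longleftrightarrow>
      ((\<lambda>U. w {..<r} * w U) has_sum w {..<r} * W) (rods l q r)"
    by (rule has_sum_cong) (rule w_split)
  ultimately have "((\<lambda>U. w ({..<r} \<union> U)) has_sum w {..<r} * W) (rods l q r)"
    by blast
  then have "(\<Sum>\<^sub>\<infinity>U\<in>rods l q r. w ({..<r} \<union> U)) = w {..<r} * W"
    by (rule infsumI)
  then have "(\<Sum>\<^sub>\<infinity>D\<in>cylindric_excited 1 l [int n] [0].
      \<Prod>x\<in>cylindric_diagram 1 l [int n] - D. 1 / real (cylindric_hook 1 l [int n] x)) = w {..<r} * W"
    unfolding excited by (subst infsum_reindex[OF inj_X]) (simp only: o_def term_eq)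
  \<comment> \<open>The fixed holes contribute the first \<open>r\<close> hook lengths and the sum
    over the rods leaves the next \<open>q * l\<close>; together they form the product in
    \<open>fact_eq_prod_hook_len\<close>.\<close>
  moreover have "fact n * (w {..<r} * W) = 1"
  proof -
    have "fact n = (fact q * real (l + 1) ^ q * (\<Prod>j<q * l + r. real (hook_len l j)))"
      using arg_cong[OF fact_eq_prod_hook_len[OF assms r, of q], of real]
      by (simp only: n of_nat_mult of_nat_fact of_nat_power of_nat_prod)
    also have "{..<q * l + r} = {..<r} \<union> {r..<r + q * l}" by auto
    also have "(\<Prod>j\<in>\<dots>. real (hook_len l j)) =
        (\<Prod>j<r. real (hook_len l j)) * (\<Prod>j=r..<r + q * l. real (hook_len l j))"
      by (rule prod.union_disjoint) auto
    finally have fact_n: "fact n = fact q * real (l + 1) ^ q *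
        ((\<Prod>j<r. real (hook_len l j)) * (\<Prod>j=r..<r + q * l. real (hook_len l j)))" .
    have "w {..<r} * W = 1 / fact n"
      unfolding fact_n w_def W_def by (simp add: prod_dividef)
    then show ?thesis by simp
  qed
  moreover have "skew_size 1 [int n] [0] = n"
    by (simp add: skew_size_def)
  ultimately show ?thesis
    unfolding hook_sum_def by (simp only:)
qed

theorem theorem5p8:
  fixes n l :: nat
  assumes "n \<ge> 1" and "l \<ge> 1"
  shows "[int n] \<in> cyl_partitions 1 l \<and> [0] \<in> cyl_partitions 1 l \<and>
    num_linear_extensions 1 l [int n] [0] = 1 \<and>
    hook_sum 1 l [int n] [0] = 1"
proof (intro conjI)
  show "[int n] \<in> cyl_partitions 1 l" "[0] \<in> cyl_partitions 1 l"
    by (simp_all add: cyl_partitions_def)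
qed (rule num_linear_extensions_single hook_sum_single[OF assms(2)])+

end
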